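(* There exists a pushdown automaton $M$ with exactly two states such that there are no finite set $\mathcal{P}$ of process identifiers, guarded recursive specification $\Delta$ over TSP with sequencing, and identifier $X\in\mathcal{P}$ for which the process graph of $X$ is bisimilar to the process graph $\mathcal{P}(M)$ of $M$.
   Context: Process graphs and bisimilarity: a process graph is a tuple $(\mathcal{S},\mathcal{A},\to,\uparrow,\downarrow)$ with states $\mathcal{S}$, actions $\mathcal{A}$ (silent action $\tau\notin\mathcal{A}$), transitions $\to\subseteq\mathcal{S}\times(\mathcal{A}\cup\{\tau\})\times\mathcal{S}$, root $\uparrow$, accepting states $\downarrow\subseteq\mathcal{S}$. A bisimulation between two process graphs is a symmetric relation $R$ on the disjoint union of their states such that whenever $s\,R\,t$: if $s\xrightarrow{a}s'$ then $t\xrightarrow{a}t'$ for some $t'$ with $s'\,R\,t'$; and if $s$ is accepting so is $t$. Graphs are bisimilar if a bisimulation relates their roots. Pushdown automaton: $M=(\mathcal{S},\mathcal{A},\mathcal{D},\to,\uparrow,\downarrow)$ with finite state set $\mathcal{S}$, finite input alphabet $\mathcal{A}$ ($\tau\notin\mathcal{A}$), finite data alphabet $\mathcal{D}$, finite set of transitions $\to\subseteq\mathcal{S}\times(\mathcal{A}\cup\{\tau\})\times(\mathcal{D}\cup\{\epsilon\})\times\mathcal{D}^*\times\mathcal{S}$ (written $s\xrightarrow{a[d/x]}t$), initial state $\uparrow$, final states $\downarrow\subseteq\mathcal{S}$. Its process graph $\mathcal{P}(M)$ has states $(s,x)$, $s\in\mathcal{S}$, $x\in\mathcal{D}^*$ (leftmost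 symbol = top of stack); $(s,dx)\xrightarrow{a}(s',x'x)$ iff $s\xrightarrow{a[d/x']}s'$ ($d\in\mathcal{D}$); $(s,\epsilon)\xrightarrow{a}(s',x)$ iff $s\xrightarrow{a[\epsilon/x]}s'$; root $(\uparrow,\epsilon)$; accepting states all $(s,x)$ with $s\in\downarrow$. TSP with sequencing: fix actions $\mathit{Act}$ ($\tau\notin\mathit{Act}$) and a finite set $\mathcal{P}$ of identifiers. Expressions: $p::=0\mid 1\mid a.p\mid p+p\mid p;p\mid X$ ($a\in\mathit{Act}\cup\{\tau\}$, $X\in\mathcal{P}$). A recursive specification $\Delta$ assigns an expression $\Delta(X)$ to each $X\in\mathcal{P}$; it is guarded if every identifier occurrence in each right-hand side lies within the scope of an action prefix. Operational semantics: $1\downarrow$; $a.p\xrightarrow{a}p$; $(p+q)\downarrow$ if $p\downarrow$ or $q\downarrow$; $p+q\xrightarrow{a}p'$ if $p\xrightarrow{a}p'$ or $q\xrightarrow{a}p'$; $(p;q)\downarrow$ if $p\downarrow$ and $q\downarrow$; $p;q\xrightarrow{a}p';q$ if $p\xrightarrow{a}p'$; $p;q\xrightarrow{a}q'$ if $p\downarrow$, $p$ has no outgoing transitions, and $q\xrightarrow{a}q'$; $X\xrightarrow{a}p'$ if $\Delta(X)\xrightarrow{a}p'$; $X\downarrow$ if $\Delta(X)\downarrow$ (for guarded $\Delta$ these rules determine a unique transition relation). The process graph of $p$ has all expressions as states, this transition relation and acceptance predicate, and root $p$. *)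

theory Defs
  imports Main
begin

section \<open>Process graphs and bisimilarity\<close>

text \<open>Labels are of type \<open>'a option\<close>: \<open>None\<close> is the silent action \<open>\<tau>\<close> and
  \<open>Some a\<close> is the proper action \<open>a\<close>.\<close>

type_synonym 'a label = "'a option"

abbreviation tau :: "'a label" where
  "tau \<equiv> None"

record ('s, 'a) process_graph =
  pg_states :: "'s set"
  pg_actions :: "'a set"
  pg_trans :: "('s \<times> 'a label \<times> 's) set"
  pg_root :: "'s"
  pg_accepting :: "'s set"

definition union_trans ::
  "('s, 'a) process_graph \<Rightarrow> ('t, 'a) process_graph \<Rightarrow> (('s + 't) \<times> 'a label \<times> ('s + 't)) set" where
  "union_trans G H =
     {(Inl s, a, Inl s') | s a s'. (s, a, s') \<in> pg_trans G} \<union>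
     {(Inr t, a, Inr t') | t a t'. (t, a, t') \<in> pg_trans H}"

definition bisimulation ::
  "('s, 'a) process_graph \<Rightarrow> ('t, 'a) process_graph \<Rightarrow> (('s + 't) \<times> ('s + 't)) set \<Rightarrow> bool" where
  "bisimulation G H R \<longleftrightarrow>
     R \<subseteq> (pg_states G <+> pg_states H) \<times> (pg_states G <+> pg_states H) \<and>
     sym R \<and>
     (\<forall>s t. (s, t) \<in> R \<longrightarrow>
        (\<forall>a s'. (s, a, s') \<in> union_trans G H \<longrightarrow>
           (\<exists>t'. (t, a, t') \<in> union_trans G H \<and> (s', t') \<in> R)) \<and>
        (s \<in> pg_accepting G <+> pg_accepting H \<longrightarrow> t \<in> pg_accepting G <+> pg_accepting H))"

definition bisimilar :: "('s, 'a) process_graph \<Rightarrow> ('t, 'a) process_graph \<Rightarrow> bool" where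
  "bisimilar G H \<longleftrightarrow> (\<exists>R. bisimulation G H R \<and> (Inl (pg_root G), Inr (pg_root H)) \<in> R)"

section \<open>Pushdown automata\<close>

text \<open>A transition \<open>(s, a, None, x, t)\<close> is one on the empty stack; \<open>(s, a, Some d, x, t)\<close>
  replaces the topmost symbol \<open>d\<close> by \<open>x\<close>. The head of a stack is its top.\<close>

record ('s, 'a, 'd) pda =
  pda_states :: "'s set"
  pda_input :: "'a set"
  pda_data :: "'d set"
  pda_trans :: "('s \<times> 'a label \<times> 'd option \<times> 'd list \<times> 's) set"
  pda_init :: "'s"
  pda_final :: "'s set"

definition pushdown_automaton :: "('s, 'a, 'd) pda \<Rightarrow> bool" where
  "pushdown_automaton M \<longleftrightarrow>
     finite (pda_states M) \<and> finite (pda_input M) \<and> finite (pda_data M) \<and>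
     finite (pda_trans M) \<and>
     pda_trans M \<subseteq> pda_states M \<times> insert tau (Some ` pda_input M) \<times>
       insert None (Some ` pda_data M) \<times> lists (pda_data M) \<times> pda_states M \<and>
     pda_init M \<in> pda_states M \<and>
     pda_final M \<subseteq> pda_states M"

definition pda_graph :: "('s, 'a, 'd) pda \<Rightarrow> ('s \<times> 'd list, 'a) process_graph" where
  "pda_graph M =
     \<lparr>pg_states = pda_states M \<times> lists (pda_data M),
      pg_actions = pda_input M,
      pg_trans =
        {((s, d # x), a, (s', x' @ x)) | s d x a s' x'.
           (s, a, Some d, x', s') \<in> pda_trans M \<and> x \<in> lists (pda_data M)} \<union>
        {((s, []), a, (s', x)) | s a s' x. (s, a, None, x, s') \<in> pda_trans M},
      pg_root = (pda_init M, []),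
      pg_accepting = pda_final M \<times> lists (pda_data M)\<rparr>"

section \<open>TSP with sequencing\<close>

text \<open>The type \<open>'a\<close> plays the role of \<open>Act\<close>; identifiers are taken from the type \<open>'v\<close>.\<close>

datatype ('a, 'v) tsp =
    Zero
  | One
  | Pre "'a label" "('a, 'v) tsp"
  | Alt "('a, 'v) tsp" "('a, 'v) tsp"
  | Seq "('a, 'v) tsp" "('a, 'v) tsp"
  | Ident 'v

abbreviation idents :: "('a, 'v) tsp \<Rightarrow> 'v set" where
  "idents \<equiv> set2_tsp"

type_synonym ('a, 'v) tsp_spec = "'v \<rightharpoonup> ('a, 'v) tsp"

definition recursive_specification :: "'v set \<Rightarrow> ('a, 'v) tsp_spec \<Rightarrow> bool" where
  "recursive_specification P \<Delta> \<longleftrightarrow> dom \<Delta> = P \<and> (\<forall>p\<in>ran \<Delta>. idents p \<subseteq> P)"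

primrec guarded_tsp :: "('a, 'v) tsp \<Rightarrow> bool" where
  "guarded_tsp Zero \<longleftrightarrow> True"
| "guarded_tsp One \<longleftrightarrow> True"
| "guarded_tsp (Pre a p) \<longleftrightarrow> True"
| "guarded_tsp (Alt p q) \<longleftrightarrow> guarded_tsp p \<and> guarded_tsp q"
| "guarded_tsp (Seq p q) \<longleftrightarrow> guarded_tsp p \<and> guarded_tsp q"
| "guarded_tsp (Ident X) \<longleftrightarrow> False"

definition guarded :: "('a, 'v) tsp_spec \<Rightarrow> bool" where
  "guarded \<Delta> \<longleftrightarrow> (\<forall>p\<in>ran \<Delta>. guarded_tsp p)"

inductive tsp_accepts :: "('a, 'v) tsp_spec \<Rightarrow> ('a, 'v) tsp \<Rightarrow> bool" for \<Delta> where
  "tsp_accepts \<Delta> One"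
| "tsp_accepts \<Delta> p \<Longrightarrow> tsp_accepts \<Delta> (Alt p q)"
| "tsp_accepts \<Delta> q \<Longrightarrow> tsp_accepts \<Delta> (Alt p q)"
| "tsp_accepts \<Delta> p \<Longrightarrow> tsp_accepts \<Delta> q \<Longrightarrow> tsp_accepts \<Delta> (Seq p q)"
| "\<Delta> X = Some p \<Longrightarrow> tsp_accepts \<Delta> p \<Longrightarrow> tsp_accepts \<Delta> (Ident X)"

text \<open>The second rule for sequencing has a negative premise. The parameter \<open>N\<close> says for which
  expressions that premise (``has no outgoing transitions'') is taken to hold; the transition
  relation \<open>T\<close> determined by the rules is the one that derives exactly itself when \<open>N\<close> is read off
  from \<open>T\<close>. For guarded specifications there is exactly one such \<open>T\<close> (lemma
  \<open>ex1_tsp_transition_relation\<close> below).\<close>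

inductive tsp_derives ::
  "('a, 'v) tsp_spec \<Rightarrow> (('a, 'v) tsp \<Rightarrow> bool) \<Rightarrow> ('a, 'v) tsp \<Rightarrow> 'a label \<Rightarrow> ('a, 'v) tsp \<Rightarrow> bool"
  for \<Delta> N where
  pre: "tsp_derives \<Delta> N (Pre a p) a p"
| alt1: "tsp_derives \<Delta> N p a p' \<Longrightarrow> tsp_derives \<Delta> N (Alt p q) a p'"
| alt2: "tsp_derives \<Delta> N q a q' \<Longrightarrow> tsp_derives \<Delta> N (Alt p q) a q'"
| seq1: "tsp_derives \<Delta> N p a p' \<Longrightarrow> tsp_derives \<Delta> N (Seq p q) a (Seq p' q)"
| seq2: "tsp_accepts \<Delta> p \<Longrightarrow> N p \<Longrightarrow> tsp_derives \<Delta> N q a q' \<Longrightarrow> tsp_derives \<Delta> N (Seq p q) a q'"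
| ident: "\<Delta> X = Some p \<Longrightarrow> tsp_derives \<Delta> N p a p' \<Longrightarrow> tsp_derives \<Delta> N (Ident X) a p'"

definition tsp_transition_relation ::
  "('a, 'v) tsp_spec \<Rightarrow> (('a, 'v) tsp \<Rightarrow> 'a label \<Rightarrow> ('a, 'v) tsp \<Rightarrow> bool) \<Rightarrow> bool" where
  "tsp_transition_relation \<Delta> T \<longleftrightarrow> T = tsp_derives \<Delta> (\<lambda>p. \<nexists>a p'. T p a p')"

definition tsp_step ::
  "('a, 'v) tsp_spec \<Rightarrow> ('a, 'v) tsp \<Rightarrow> 'a label \<Rightarrow> ('a, 'v) tsp \<Rightarrow> bool" where
  "tsp_step \<Delta> = (THE T. tsp_transition_relation \<Delta> T)"

definition tsp_graph ::
  "'v set \<Rightarrow> ('a, 'v) tsp_spec \<Rightarrow> ('a, 'v) tsp \<Rightarrow> (('a, 'v) tsp, 'a) process_graph" where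
  "tsp_graph P \<Delta> p =
     \<lparr>pg_states = {q. idents q \<subseteq> P},
      pg_actions = UNIV,
      pg_trans = {(q, a, q'). idents q \<subseteq> P \<and> idents q' \<subseteq> P \<and> tsp_step \<Delta> q a q'},
      pg_root = p,
      pg_accepting = {q. idents q \<subseteq> P \<and> tsp_accepts \<Delta> q}\<rparr>"

subsection \<open>Well-definedness of the transition relation\<close>

primrec tsp_succs :: "('a, 'v) tsp_spec \<Rightarrow> ('v \<Rightarrow> ('a label \<times> ('a, 'v) tsp) set) \<Rightarrow>
    ('a, 'v) tsp \<Rightarrow> ('a label \<times> ('a, 'v) tsp) set" where
  "tsp_succs \<Delta> \<rho> Zero = {}"
| "tsp_succs \<Delta> \<rho> One = {}"
| "tsp_succs \<Delta> \<rho> (Pre a p) = {(a, p)}"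
| "tsp_succs \<Delta> \<rho> (Alt p q) = tsp_succs \<Delta> \<rho> p \<union> tsp_succs \<Delta> \<rho> q"
| "tsp_succs \<Delta> \<rho> (Seq p q) = {(a, Seq p' q) | a p'. (a, p') \<in> tsp_succs \<Delta> \<rho> p} \<union>
     (if tsp_accepts \<Delta> p \<and> tsp_succs \<Delta> \<rho> p = {} then tsp_succs \<Delta> \<rho> q else {})"
| "tsp_succs \<Delta> \<rho> (Ident X) = \<rho> X"

lemma tsp_succs_guarded: "guarded_tsp p \<Longrightarrow> tsp_succs \<Delta> \<rho> p = tsp_succs \<Delta> \<rho>' p"
  by (induction p) auto

inductive_cases tsp_derives_ZeroE: "tsp_derives \<Delta> N Zero a r"
inductive_cases tsp_derives_OneE: "tsp_derives \<Delta> N One a r"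
inductive_cases tsp_derives_PreE: "tsp_derives \<Delta> N (Pre b p) a r"
inductive_cases tsp_derives_AltE: "tsp_derives \<Delta> N (Alt p q) a r"
inductive_cases tsp_derives_SeqE: "tsp_derives \<Delta> N (Seq p q) a r"
inductive_cases tsp_derives_IdentE: "tsp_derives \<Delta> N (Ident X) a r"

lemmas tsp_derives_elims = tsp_derives_ZeroE tsp_derives_OneE tsp_derives_PreE
  tsp_derives_AltE tsp_derives_SeqE tsp_derives_IdentE

lemma tsp_derives_simps:
  "tsp_derives \<Delta> N Zero a r \<longleftrightarrow> False"
  "tsp_derives \<Delta> N One a r \<longleftrightarrow> False"
  "tsp_derives \<Delta> N (Pre b p) a r \<longleftrightarrow> b = a \<and> p = r"
  "tsp_derives \<Delta> N (Alt p q) a r \<longleftrightarrow> tsp_derives \<Delta> N p a r \<or> tsp_derives \<Delta> N q a r"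
  "tsp_derives \<Delta> N (Seq p q) a r \<longleftrightarrow> (\<exists>p'. r = Seq p' q \<and> tsp_derives \<Delta> N p a p') \<or>
     tsp_accepts \<Delta> p \<and> N p \<and> tsp_derives \<Delta> N q a r"
  "tsp_derives \<Delta> N (Ident X) a r \<longleftrightarrow> (\<exists>p. \<Delta> X = Some p \<and> tsp_derives \<Delta> N p a r)"
  by (auto intro: tsp_derives.intros elim: tsp_derives_elims)

lemma tsp_transition_relation_succs:
  assumes "tsp_transition_relation \<Delta> T"
  shows "{(a, r). T p a r} = tsp_succs \<Delta> (\<lambda>X. {(a, r). T (Ident X) a r}) p"
proof -
  let ?N = "\<lambda>p. \<nexists>a p'. T p a p'"
  have T: "T = tsp_derives \<Delta> ?N"
    using assms by (simp add: tsp_transition_relation_def)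
  have eqs: "T Zero a r \<longleftrightarrow> False" "T One a r \<longleftrightarrow> False" "T (Pre b p) a r \<longleftrightarrow> b = a \<and> p = r"
    "T (Alt p q) a r \<longleftrightarrow> T p a r \<or> T q a r"
    "T (Seq p q) a r \<longleftrightarrow> (\<exists>p'. r = Seq p' q \<and> T p a p') \<or> tsp_accepts \<Delta> p \<and> ?N p \<and> T q a r"
    for a b p q r
    using tsp_derives_simps[of \<Delta> ?N, folded T] by auto
  show ?thesis
  proof (induction p)
    case (Alt p q)
    have "{(a, r). T (Alt p q) a r} = {(a, r). T p a r} \<union> {(a, r). T q a r}"
      by (auto simp: eqs)
    then show ?case by (simp add: Alt.IH)
  next
    case (Seq p q)
    have "{(a, r). T (Seq p q) a r} = {(a, Seq p' q) | a p'. (a, p') \<in> {(a, r). T p a r}} \<union>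
        (if tsp_accepts \<Delta> p \<and> {(a, r). T p a r} = {} then {(a, r). T q a r} else {})"
      by (auto simp: eqs)
    then show ?case by (simp only: Seq.IH tsp_succs.simps)
  qed (auto simp: eqs)
qed

lemma ex1_tsp_transition_relation:
  assumes "guarded \<Delta>"
  shows "\<exists>!T. tsp_transition_relation \<Delta> T"
proof (rule ex_ex1I)
  define \<rho> where "\<rho> X = (case \<Delta> X of None \<Rightarrow> {} | Some q \<Rightarrow> tsp_succs \<Delta> (\<lambda>_. {}) q)" for X
  define T where "T p a r \<longleftrightarrow> (a, r) \<in> tsp_succs \<Delta> \<rho> p" for p a r
  let ?N = "\<lambda>p. \<nexists>a p'. T p a p'"
  have \<rho>: "\<rho> X = tsp_succs \<Delta> \<rho> q" if "\<Delta> X = Some q" for X q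
    using that assms tsp_succs_guarded[of q \<Delta> "\<lambda>_. {}" \<rho>]
    by (auto simp: \<rho>_def guarded_def ran_def)
  have 1: "tsp_derives \<Delta> ?N p a r \<longleftrightarrow> (a, r) \<in> tsp_succs \<Delta> \<rho> p" if "guarded_tsp p" for p a r
    using that by (induction p arbitrary: a r) (auto simp: tsp_derives_simps T_def)
  have "tsp_derives \<Delta> ?N p a r \<longleftrightarrow> (a, r) \<in> tsp_succs \<Delta> \<rho> p" for p a r
  proof (induction p arbitrary: a r)
    case (Ident X)
    show ?case
    proof (cases "\<Delta> X")
      case None
      then show ?thesis by (simp add: tsp_derives_simps \<rho>_def)
    next
      case (Some q)
      then have "guarded_tsp q"
        using assms by (auto simp: guarded_def ran_def)
      then show ?thesis using Some 1[of q a r] by (simp add: tsp_derives_simps \<rho>)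
    qed
  qed (auto simp: tsp_derives_simps T_def)
  then have "tsp_transition_relation \<Delta> T"
    by (auto simp: tsp_transition_relation_def T_def fun_eq_iff)
  then show "\<exists>T. tsp_transition_relation \<Delta> T" by (rule exI[of _ T])
next
  fix T U
  assume T: "tsp_transition_relation \<Delta> T" and U: "tsp_transition_relation \<Delta> U"
  have id: "V (Ident X) a r \<longleftrightarrow> (\<exists>p. \<Delta> X = Some p \<and> V p a r)"
    if "tsp_transition_relation \<Delta> V" for V X a r
    using tsp_derives_simps(6)[of \<Delta> "\<lambda>p. \<nexists>a p'. V p a p'"] that
    by (simp add: tsp_transition_relation_def)
  have "{(a, r). T p a r} = {(a, r). U p a r}" if "guarded_tsp p" for p
    using tsp_succs_guarded[OF that] tsp_transition_relation_succs[OF T, of p]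
      tsp_transition_relation_succs[OF U, of p] by metis
  then have g: "T p a r \<longleftrightarrow> U p a r" if "guarded_tsp p" for p a r
    using that by blast
  have "T (Ident X) a r \<longleftrightarrow> U (Ident X) a r" for X a r
    using assms g by (auto simp: id[OF T] id[OF U] guarded_def ran_def)
  then have "{(a, r). T p a r} = {(a, r). U p a r}" for p
    by (simp add: tsp_transition_relation_succs[OF T, of p] tsp_transition_relation_succs[OF U, of p])
  then show "T = U"
    by (auto simp: fun_eq_iff set_eq_iff)
qed

lemma tsp_transition_relation_tsp_step:
  assumes "guarded \<Delta>"
  shows "tsp_transition_relation \<Delta> (tsp_step \<Delta>)"
  unfolding tsp_step_def by (rule theI'[OF ex1_tsp_transition_relation[OF assms]])

lemma tsp_step_simps:
  assumes "guarded \<Delta>"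
  shows "tsp_step \<Delta> Zero a r \<longleftrightarrow> False"
    "tsp_step \<Delta> One a r \<longleftrightarrow> False"
    "tsp_step \<Delta> (Pre b p) a r \<longleftrightarrow> b = a \<and> p = r"
    "tsp_step \<Delta> (Alt p q) a r \<longleftrightarrow> tsp_step \<Delta> p a r \<or> tsp_step \<Delta> q a r"
    "tsp_step \<Delta> (Seq p q) a r \<longleftrightarrow> (\<exists>p'. r = Seq p' q \<and> tsp_step \<Delta> p a p') \<or>
       tsp_accepts \<Delta> p \<and> (\<nexists>b p'. tsp_step \<Delta> p b p') \<and> tsp_step \<Delta> q a r"
    "tsp_step \<Delta> (Ident X) a r \<longleftrightarrow> (\<exists>p. \<Delta> X = Some p \<and> tsp_step \<Delta> p a r)"
  using tsp_derives_simps[of \<Delta> "\<lambda>p. \<nexists>a p'. tsp_step \<Delta> p a p'",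
      folded tsp_transition_relation_tsp_step[OF assms, unfolded tsp_transition_relation_def]]
  by auto

end

theory Submission
  imports Defs
begin

text \<open>
  The automaton is a counter with an up/down mode (state 0) and a down-only mode (state 1): action 0
  increments, action 1 decrements, and action 2 switches irrevocably to the down-only mode.
  Every expression reachable from an identifier is a left-nested sequence \<open>h; q\<^sub>1; \<dots>; q\<^sub>k\<close> whose
  components come from a fixed finite set. Suppose it is bisimilar to the counter with value \<open>n\<close> in the
  up/down mode, where we may assume that \<open>h\<close> has not terminated. If \<open>h\<close> terminated during the run
  \<open>1\<^sup>n\<close> and also during the run \<open>2 1\<^sup>n\<close>, then the same tail \<open>q\<^sub>1; \<dots>; q\<^sub>k\<close> would be bisimilar to a
  configuration of either mode, but action 0 is enabled in only one of them. So \<open>h\<close> performs one of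
  these two runs in full by itself, whence \<open>h\<close> determines \<open>n\<close> up to two values. As there
  are only finitely many \<open>h\<close>, this is impossible.
\<close>

section \<open>Traces and sequences of expressions\<close>

definition terminated :: "('a, 'v) tsp_spec \<Rightarrow> ('a, 'v) tsp \<Rightarrow> bool" where
  "terminated \<Delta> p \<longleftrightarrow> tsp_accepts \<Delta> p \<and> (\<nexists>a p'. tsp_step \<Delta> p a p')"

primrec has_trace :: "('a, 'v) tsp_spec \<Rightarrow> ('a, 'v) tsp \<Rightarrow> 'a label list \<Rightarrow> bool" where
  "has_trace \<Delta> p [] \<longleftrightarrow> True"
| "has_trace \<Delta> p (a # w) \<longleftrightarrow> (\<exists>p'. tsp_step \<Delta> p a p' \<and> has_trace \<Delta> p' w)"

lemma has_trace_appendD: "has_trace \<Delta> p (u @ v) \<Longrightarrow> has_trace \<Delta> p u"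
  by (induction u arbitrary: p) auto

text \<open>Traces are prefix-closed, so two distinct members would contradict each other: the set
  has at most one element.\<close>

lemma finite_maximal_trace_lengths:
  "finite {n. has_trace \<Delta> p (w @ replicate n b) \<and> \<not> has_trace \<Delta> p (w @ replicate (Suc n) b)}"
    (is "finite ?A")
proof -
  have no_less: "\<not> n < m" if "n \<in> ?A" "m \<in> ?A" for n m
  proof
    assume "n < m"
    then have "replicate m b = replicate (Suc n) b @ replicate (m - Suc n) b"
      by (simp flip: replicate_add del: replicate_Suc)
    then have "has_trace \<Delta> p ((w @ replicate (Suc n) b) @ replicate (m - Suc n) b)"
      using that(2) by simp
    with that(1) show False
      using has_trace_appendD by blast
  qed
  show ?thesis
  proof (cases "?A = {}")
    case False
    then obtain n where "n \<in> ?A" by blast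
    then have "m = n" if "m \<in> ?A" for m
      using no_less[of m n] no_less[of n m] that by linarith
    then have "?A \<subseteq> {n}"
      by blast
    then show ?thesis
      using finite_subset by blast
  next
    case True
    then show ?thesis by (simp only: finite.emptyI)
  qed
qed

text \<open>The head can always move on by the first sequencing rule, whatever follows it. The
  converse fails, since the tail may contribute to a trace.\<close>

lemma has_trace_foldl_Seq:
  assumes "guarded \<Delta>" "has_trace \<Delta> h w"
  shows "has_trace \<Delta> (foldl Seq h qs) w"
proof -
  have Seq: "has_trace \<Delta> (Seq p q) w" if "has_trace \<Delta> p w" for p q
    using that by (induction w arbitrary: p) (auto simp: tsp_step_simps[OF assms(1)])
  show ?thesis
    using assms(2) by (induction qs arbitrary: h) (auto intro: Seq)
qed

text \<open>The steps that remain once the head has terminated. The empty tail gets its own clause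
  because \<open>foldl Seq\<close> has no expression for the empty sequence.\<close>

primrec tail_step ::
  "('a, 'v) tsp_spec \<Rightarrow> ('a, 'v) tsp list \<Rightarrow> 'a label \<Rightarrow> ('a, 'v) tsp \<Rightarrow> bool" where
  "tail_step \<Delta> [] a r \<longleftrightarrow> False"
| "tail_step \<Delta> (q # qs) a r \<longleftrightarrow> tsp_step \<Delta> (foldl Seq q qs) a r"

lemma tsp_accepts_Seq_iff: "tsp_accepts \<Delta> (Seq p q) \<longleftrightarrow> tsp_accepts \<Delta> p \<and> tsp_accepts \<Delta> q"
  by (auto elim: tsp_accepts.cases intro: tsp_accepts.intros)

text \<open>The first tail component is absorbed into the head, which becomes
  \<open>Seq h q\<close>; hence the induction with arbitrary \<open>h\<close>. The factor
  \<open>tail_step\<close> does not mention \<open>h\<close>, which lets one tail be compared in two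
  different runs.\<close>

lemma tsp_step_foldl_Seq:
  assumes "guarded \<Delta>"
  shows "tsp_step \<Delta> (foldl Seq h qs) a r \<longleftrightarrow>
    (\<exists>h'. r = foldl Seq h' qs \<and> tsp_step \<Delta> h a h') \<or> terminated \<Delta> h \<and> tail_step \<Delta> qs a r"
proof (induction qs arbitrary: h)
  case (Cons q qs)
  have "terminated \<Delta> (Seq h q) \<longleftrightarrow> terminated \<Delta> h \<and> terminated \<Delta> q"
    unfolding terminated_def tsp_accepts_Seq_iff tsp_step_simps[OF assms] by blast
  moreover have "tsp_step \<Delta> (Seq h q) a h' \<longleftrightarrow>
      (\<exists>h1. h' = Seq h1 q \<and> tsp_step \<Delta> h a h1) \<or> terminated \<Delta> h \<and> tsp_step \<Delta> q a h'" for h'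
    by (auto simp: terminated_def tsp_step_simps[OF assms])
  ultimately show ?case
    by (auto simp: Cons.IH[of "Seq h q"] Cons.IH[of q])
qed simp

section \<open>Reachable expressions\<close>

definition subterm_closed :: "('a, 'v) tsp_spec \<Rightarrow> ('a, 'v) tsp set \<Rightarrow> bool" where
  "subterm_closed \<Delta> S \<longleftrightarrow>
     (\<forall>a p. Pre a p \<in> S \<longrightarrow> p \<in> S) \<and>
     (\<forall>p q. Alt p q \<in> S \<longrightarrow> p \<in> S \<and> q \<in> S) \<and>
     (\<forall>p q. Seq p q \<in> S \<longrightarrow> p \<in> S \<and> q \<in> S) \<and>
     (\<forall>X p. Ident X \<in> S \<longrightarrow> \<Delta> X = Some p \<longrightarrow> p \<in> S)"

primrec subterms :: "('a, 'v) tsp \<Rightarrow> ('a, 'v) tsp set" where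
  "subterms Zero = {Zero}"
| "subterms One = {One}"
| "subterms (Pre a p) = insert (Pre a p) (subterms p)"
| "subterms (Alt p q) = insert (Alt p q) (subterms p \<union> subterms q)"
| "subterms (Seq p q) = insert (Seq p q) (subterms p \<union> subterms q)"
| "subterms (Ident X) = {Ident X}"

lemma self_in_subterms: "p \<in> subterms p"
  by (cases p) auto

lemma subterms_trans: "q \<in> subterms p \<Longrightarrow> subterms q \<subseteq> subterms p"
  by (induction p) auto

lemma finite_subterms: "finite (subterms p)"
  by (induction p) auto

text \<open>\<open>subterms\<close> does not unfold identifiers and hence is finite; collecting the
  subterms of all right-hand sides closes the set under unfolding.\<close>

lemma finite_subterm_closed_exists:
  assumes "finite (dom \<Delta>)"
  obtains S where "finite S" "subterm_closed \<Delta> S" "Ident ` dom \<Delta> \<subseteq> S"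
proof
  let ?S = "Ident ` dom \<Delta> \<union> (\<Union>p\<in>ran \<Delta>. subterms p)"
  show "finite ?S"
    using assms by (simp add: finite_ran finite_subterms)
  have sub: "r \<in> ?S" if "q \<in> ?S" "q \<notin> Ident ` dom \<Delta>" "r \<in> subterms q" for q r
  proof -
    from that(1,2) obtain p where "p \<in> ran \<Delta>" "q \<in> subterms p" by auto
    with subterms_trans[of q p] that(3) show ?thesis by auto
  qed
  show "subterm_closed \<Delta> ?S"
    unfolding subterm_closed_def
  proof (intro conjI allI impI)
    fix X p
    assume "\<Delta> X = Some p"
    then show "p \<in> ?S"
      using self_in_subterms[of p] by (auto simp: ran_def)
  qed (rule sub, assumption, force, simp add: self_in_subterms)+
qed simp

text \<open>Built from the left because the first sequencing rule changes the left operand and keeps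
  the right one.\<close>

inductive_set sequences :: "('a, 'v) tsp set \<Rightarrow> ('a, 'v) tsp set" for S where
  base: "p \<in> S \<Longrightarrow> p \<in> sequences S"
| Seq: "p \<in> sequences S \<Longrightarrow> q \<in> S \<Longrightarrow> Seq p q \<in> sequences S"

lemma sequences_foldl:
  assumes "r \<in> sequences S"
  obtains h qs where "h \<in> S" "set qs \<subseteq> S" "r = foldl Seq h qs"
proof -
  have "\<exists>h qs. h \<in> S \<and> set qs \<subseteq> S \<and> r = foldl Seq h qs"
    using assms
  proof induction
    case (base p)
    then show ?case by (intro exI[of _ p] exI[of _ "[]"]) simp
  next
    case (Seq p q)
    then obtain h qs where "h \<in> S" "set qs \<subseteq> S" "p = foldl Seq h qs" by blast
    with Seq show ?case by (intro exI[of _ h] exI[of _ "qs @ [q]"]) simp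
  qed
  with that show thesis by blast
qed

lemma sequences_simps:
  "Pre a p \<in> sequences S \<longleftrightarrow> Pre a p \<in> S"
  "Alt p q \<in> sequences S \<longleftrightarrow> Alt p q \<in> S"
  "Seq p q \<in> sequences S \<longleftrightarrow> Seq p q \<in> S \<or> p \<in> sequences S \<and> q \<in> S"
  "Ident X \<in> sequences S \<longleftrightarrow> Ident X \<in> S"
  by (subst sequences.simps; simp)+

lemma subterm_closedD:
  assumes "subterm_closed \<Delta> S"
  shows "Pre a p \<in> S \<Longrightarrow> p \<in> S"
    and "Alt p q \<in> S \<Longrightarrow> p \<in> S" "Alt p q \<in> S \<Longrightarrow> q \<in> S"
    and "Seq p q \<in> S \<Longrightarrow> p \<in> S" "Seq p q \<in> S \<Longrightarrow> q \<in> S"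
    and "Ident X \<in> S \<Longrightarrow> \<Delta> X = Some p \<Longrightarrow> p \<in> S"
  using assms unfolding subterm_closed_def by blast+

text \<open>A step either changes the leftmost component, which may itself unfold into a sequence
  over \<open>S\<close>, or passes control to a later component.\<close>

lemma tsp_derives_sequences:
  assumes "subterm_closed \<Delta> S" "tsp_derives \<Delta> N p a p'" "p \<in> sequences S"
  shows "p' \<in> sequences S"
  using assms(2,3)
  by induction (auto simp: sequences_simps intro: sequences.base dest: subterm_closedD[OF assms(1)])

lemma tsp_derives_idents:
  assumes "recursive_specification P \<Delta>" "tsp_derives \<Delta> N p a p'" "idents p \<subseteq> P"
  shows "idents p' \<subseteq> P"
  using assms(2,3) by induction
    (use assms(1) in \<open>auto simp: recursive_specification_def ran_def\<close>)

lemma tsp_step_derives: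
  assumes "guarded \<Delta>" "tsp_step \<Delta> p a p'"
  shows "tsp_derives \<Delta> (\<lambda>p. \<nexists>a p'. tsp_step \<Delta> p a p') p a p'"
proof -
  have eq: "tsp_step \<Delta> = tsp_derives \<Delta> (\<lambda>p. \<nexists>a p'. tsp_step \<Delta> p a p')"
    using tsp_transition_relation_tsp_step[OF assms(1)] unfolding tsp_transition_relation_def .
  \<comment> \<open>The equation has \<open>tsp_step\<close> on both sides, so it is instantiated
    once instead of being used for rewriting.\<close>
  show ?thesis
    using assms(2) fun_cong[OF fun_cong[OF fun_cong[OF eq]], of p a p'] by (rule rev_iffD1)
qed

section \<open>The two-mode counter\<close>

text \<open>\<open>True\<close> stands for the up/down mode, which the switch leaves for
  good.\<close>

inductive counter_step :: "bool \<times> nat \<Rightarrow> nat label \<Rightarrow> bool \<times> nat \<Rightarrow> bool" where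
  inc: "counter_step (True, n) (Some 0) (True, Suc n)"
| dec: "counter_step (s, Suc n) (Some 1) (s, n)"
| switch: "counter_step (True, n) (Some 2) (False, n)"

lemma counter_step_simps:
  "counter_step (s, n) (Some 0) v \<longleftrightarrow> s \<and> v = (True, Suc n)"
  "counter_step (s, n) (Some (Suc 0)) v \<longleftrightarrow> (\<exists>m. n = Suc m \<and> v = (s, m))"
  "counter_step (s, n) (Some 2) v \<longleftrightarrow> s \<and> v = (False, n)"
  by (auto simp: counter_step.simps)

text \<open>The transfer properties of a bisimulation with the counter. By \<open>step_ext\<close>
  the relation depends only on the outgoing transitions of an expression; this serves to discard
  terminated heads.\<close>

locale counter_bisimulation =
  fixes \<Delta> :: "(nat, 'v) tsp_spec" and B :: "(nat, 'v) tsp \<Rightarrow> bool \<times> nat \<Rightarrow> bool"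
  assumes guarded: "guarded \<Delta>"
    and forward: "B p u \<Longrightarrow> tsp_step \<Delta> p a p' \<Longrightarrow> \<exists>u'. counter_step u a u' \<and> B p' u'"
    and backward: "B p u \<Longrightarrow> counter_step u a u' \<Longrightarrow> \<exists>p'. tsp_step \<Delta> p a p' \<and> B p' u'"
    and step_ext: "B p u \<Longrightarrow> (\<And>a r. tsp_step \<Delta> p a r \<longleftrightarrow> tsp_step \<Delta> q a r) \<Longrightarrow> B q u"
begin

lemma inc_enabled_iff:
  assumes "B p (s, n)"
  shows "(\<exists>r. tsp_step \<Delta> p (Some 0) r) \<longleftrightarrow> s"
  using forward[OF assms] backward[OF assms] by (force simp: counter_step_simps)

text \<open>Decrementing is deterministic in the counter, so whichever branch the expression takes,
  it stays related to the next lower value.\<close>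

lemma not_too_many_decs: "B p (s, n) \<Longrightarrow> \<not> has_trace \<Delta> p (replicate (Suc n) (Some 1))"
proof (induction n arbitrary: p)
  case 0
  then show ?case using forward by (fastforce simp: counter_step_simps)
next
  case (Suc n)
  show ?case
  proof
    assume "has_trace \<Delta> p (replicate (Suc (Suc n)) (Some 1))"
    then obtain p' where p': "tsp_step \<Delta> p (Some 1) p'" "has_trace \<Delta> p' (replicate (Suc n) (Some 1))"
      by auto
    from forward[OF Suc.prems p'(1)] have "B p' (s, n)"
      by (auto simp: counter_step_simps)
    with p'(2) Suc.IH show False by blast
  qed
qed

text \<open>The head is followed along the decrements. If it terminates while the value is still
  positive, only the tail can act, and it must reveal the mode through action 0. Since
  \<open>qs\<close> never changes, the second alternative cannot hold for both modes.\<close>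

lemma head_dec_trace_or_tail_mode:
  assumes "B (foldl Seq h qs) (s, n)"
  shows "has_trace \<Delta> h (replicate n (Some 1)) \<or> ((\<exists>r. tail_step \<Delta> qs (Some 0) r) \<longleftrightarrow> s)"
  using assms
proof (induction n arbitrary: h)
  case (Suc n)
  show ?case
  proof (cases "terminated \<Delta> h")
    case True
    then have "tsp_step \<Delta> (foldl Seq h qs) (Some 0) r \<longleftrightarrow> tail_step \<Delta> qs (Some 0) r" for r
      by (auto simp: tsp_step_foldl_Seq[OF guarded] terminated_def)
    with inc_enabled_iff[OF Suc.prems] show ?thesis by simp
  next
    case False
    obtain r where "tsp_step \<Delta> (foldl Seq h qs) (Some 1) r" "B r (s, n)"
      using backward[OF Suc.prems] dec by blast
    with False obtain h' where "tsp_step \<Delta> h (Some 1) h'" "B (foldl Seq h' qs) (s, n)"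
      by (auto simp: tsp_step_foldl_Seq[OF guarded])
    with Suc.IH show ?thesis by auto
  qed
qed simp

text \<open>A terminated head contributes no transitions and is dropped by \<open>step_ext\<close>.
  This stops at the last component at the latest, since the up/down mode always enables action
  0.\<close>

lemma nonterminated_head:
  assumes "B (foldl Seq h qs) (True, n)" "h \<in> S" "set qs \<subseteq> S"
  shows "\<exists>h'\<in>S. \<exists>qs'. \<not> terminated \<Delta> h' \<and> B (foldl Seq h' qs') (True, n)"
  using assms
proof (induction qs arbitrary: h)
  case Nil
  then have "\<not> terminated \<Delta> h"
    using inc_enabled_iff by (fastforce simp: terminated_def)
  with Nil.prems show ?case by blast
next
  case (Cons q qs)
  show ?case
  proof (cases "terminated \<Delta> h")
    case True
    then have "tsp_step \<Delta> (foldl Seq h (q # qs)) a r \<longleftrightarrow> tsp_step \<Delta> (foldl Seq q qs) a r" for a r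
      by (subst tsp_step_foldl_Seq[OF guarded]) (auto simp: terminated_def)
    then have "B (foldl Seq q qs) (True, n)"
      by (rule step_ext[OF Cons.prems(1)])
    then show ?thesis
      using Cons.IH[of q] Cons.prems(3) by simp
  next
    case False
    with Cons.prems show ?thesis by blast
  qed
qed

text \<open>\<open>w\<close> records which run \<open>h\<close> completes alone: the decrements at
  once or after the switch. A longer trace of \<open>h\<close> would be one of the whole sequence
  and exceed the counter.\<close>

lemma head_determines_value:
  assumes "B (foldl Seq h qs) (True, n)" "\<not> terminated \<Delta> h"
  shows "\<exists>w\<in>{[], [Some 2]}. has_trace \<Delta> h (w @ replicate n (Some 1)) \<and>
    \<not> has_trace \<Delta> h (w @ replicate (Suc n) (Some 1))"
proof -
  obtain r where "tsp_step \<Delta> (foldl Seq h qs) (Some 2) r" "B r (False, n)"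
    using backward[OF assms(1)] switch by blast
  \<comment> \<open>As \<open>h\<close> has not terminated, it performs the switch itself and leaves
    \<open>qs\<close> intact.\<close>
  with assms(2) obtain h' where h': "tsp_step \<Delta> h (Some 2) h'" "B (foldl Seq h' qs) (False, n)"
    by (auto simp: tsp_step_foldl_Seq[OF guarded])
  have "\<not> has_trace \<Delta> (foldl Seq h qs) ([Some 2] @ replicate (Suc n) (Some 1))"
  proof
    assume "has_trace \<Delta> (foldl Seq h qs) ([Some 2] @ replicate (Suc n) (Some 1))"
    then obtain p where p: "tsp_step \<Delta> (foldl Seq h qs) (Some 2) p"
      "has_trace \<Delta> p (replicate (Suc n) (Some 1))"
      by auto
    from forward[OF assms(1) p(1)] have "B p (False, n)"
      by (auto simp: counter_step_simps)
    with p(2) not_too_many_decs show False by blast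
  qed
  then have "\<not> has_trace \<Delta> h ([Some 2] @ replicate (Suc n) (Some 1))"
    using has_trace_foldl_Seq[OF guarded] by blast
  moreover have "\<not> has_trace \<Delta> h ([] @ replicate (Suc n) (Some 1))"
    using has_trace_foldl_Seq[OF guarded] not_too_many_decs[OF assms(1)]
    unfolding append_Nil by blast
  \<comment> \<open>Otherwise the common tail \<open>qs\<close> would both enable and not enable
    action 0.\<close>
  moreover have "has_trace \<Delta> h (replicate n (Some 1)) \<or> has_trace \<Delta> h' (replicate n (Some 1))"
    using head_dec_trace_or_tail_mode[OF assms(1)] head_dec_trace_or_tail_mode[OF h'(2)] by blast
  ultimately show ?thesis
    using h'(1) by auto
qed

lemma sequences_reach_all_values:
  assumes "subterm_closed \<Delta> S" "p \<in> sequences S" "B p (True, 0)"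
  shows "\<exists>r\<in>sequences S. B r (True, n)"
proof (induction n)
  case (Suc n)
  then obtain r where r: "r \<in> sequences S" "B r (True, n)" by blast
  then obtain r' where r': "tsp_step \<Delta> r (Some 0) r'" "B r' (True, Suc n)"
    using backward inc by blast
  have "r' \<in> sequences S"
    using tsp_derives_sequences[OF assms(1) tsp_step_derives[OF guarded r'(1)] r(1)] .
  with r'(2) show ?case by blast
next
  case 0
  show ?case using assms(2,3) by blast
qed

lemma no_finite_subterm_closed:
  assumes "finite S" "subterm_closed \<Delta> S" "p \<in> sequences S" "B p (True, 0)"
  shows False
proof -
  define A where "A h w = {n. has_trace \<Delta> h (w @ replicate n (Some 1)) \<and>
    \<not> has_trace \<Delta> h (w @ replicate (Suc n) (Some 1))}" for h w
  \<comment> \<open>Each \<open>A h w\<close> has at most one element, yet these finitely many sets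
    together have to cover all counter values.\<close>
  have "n \<in> (\<Union>h\<in>S. A h [] \<union> A h [Some 2])" for n
  proof -
    obtain r where "r \<in> sequences S" "B r (True, n)"
      using sequences_reach_all_values[OF assms(2-4)] by blast
    then obtain h qs where "h \<in> S" "set qs \<subseteq> S" "B (foldl Seq h qs) (True, n)"
      by (elim sequences_foldl) simp
    then obtain h' qs' where h': "h' \<in> S" "\<not> terminated \<Delta> h'" "B (foldl Seq h' qs') (True, n)"
      using nonterminated_head by blast
    from head_determines_value[OF h'(3,2)] have "n \<in> A h' [] \<union> A h' [Some 2]"
      unfolding A_def by blast
    with h'(1) show ?thesis by blast
  qed
  then have "(\<Union>h\<in>S. A h [] \<union> A h [Some 2]) = UNIV"
    by blast
  moreover have "finite (A h w)" for h w
    unfolding A_def by (rule finite_maximal_trace_lengths)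
  then have "finite (\<Union>h\<in>S. A h [] \<union> A h [Some 2])"
    using assms(1) by simp
  ultimately show False
    by simp
qed

end

section \<open>The two-state automaton realising the counter\<close>

definition counter_pda :: "(nat, nat, nat) pda" where
  "counter_pda =
     \<lparr>pda_states = {0, 1}, pda_input = {0, 1, 2}, pda_data = {0},
      pda_trans =
        {(0, Some 0, None, [0], 0), (0, Some 0, Some 0, [0, 0], 0),
         (0, Some 1, Some 0, [], 0), (1, Some 1, Some 0, [], 1),
         (0, Some 2, None, [], 1), (0, Some 2, Some 0, [0], 1)},
      pda_init = 0, pda_final = {}\<rparr>"

definition config :: "bool \<times> nat \<Rightarrow> nat \<times> nat list" where
  "config = (\<lambda>(s, n). (if s then 0 else 1, replicate n 0))"

lemma pushdown_automaton_counter_pda: "pushdown_automaton counter_pda"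
  by (auto simp: pushdown_automaton_def counter_pda_def)

text \<open>The stack holds the value in unary. Incrementing and switching are possible at value 0
  too, so each has two rules, the one for a nonempty stack putting the popped symbol back.\<close>

lemma counter_pda_trans_iff:
  "(config u, a, v) \<in> pg_trans (pda_graph counter_pda) \<longleftrightarrow> (\<exists>u'. v = config u' \<and> counter_step u a u')"
proof (cases u)
  case (Pair s n)
  have "replicate n (0 :: nat) \<in> lists {0}" for n
    by auto
  then show ?thesis
    unfolding Pair
    by (cases n; cases s)
      (auto simp: pda_graph_def counter_pda_def config_def counter_step.simps)
qed

text \<open>\<open>R\<close> itself need not satisfy \<open>step_ext\<close>, so it is closed under
  equality of outgoing transitions. The transfer properties survive: equal transitions lead to the
  same targets, and these are related by \<open>R\<close> directly.\<close>

lemma counter_bisimulationI: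
  assumes "recursive_specification P \<Delta>" "guarded \<Delta>"
    and R: "bisimulation (tsp_graph P \<Delta> p) (pda_graph counter_pda) R"
  shows "counter_bisimulation \<Delta>
    (\<lambda>p u. \<exists>q. (\<forall>a r. tsp_step \<Delta> p a r \<longleftrightarrow> tsp_step \<Delta> q a r) \<and> (Inl q, Inr (config u)) \<in> R)"
proof -
  let ?G = "tsp_graph P \<Delta> p" and ?H = "pda_graph counter_pda"
  have R_step: "\<exists>t'. (t, a, t') \<in> union_trans ?G ?H \<and> (s', t') \<in> R"
    if "(s, t) \<in> R" "(s, a, s') \<in> union_trans ?G ?H" for s t a s'
    using R that unfolding bisimulation_def by blast
  have "sym R"
    using R by (simp add: bisimulation_def)
  \<comment> \<open>The graph restricts steps to expressions over \<open>P\<close>. Expressions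
    occurring in \<open>R\<close> are over \<open>P\<close>, and steps preserve this.\<close>
  have step_G: "(Inl q, a, z) \<in> union_trans ?G ?H \<longleftrightarrow> (\<exists>q'. z = Inl q' \<and> tsp_step \<Delta> q a q')"
    if "(Inl q, t) \<in> R" for q t a z
  proof -
    have "idents q \<subseteq> P"
      using R that by (auto simp: bisimulation_def tsp_graph_def)
    then have "idents q' \<subseteq> P" if "tsp_step \<Delta> q a q'" for q'
      using tsp_derives_idents[OF assms(1) tsp_step_derives[OF assms(2) that]] by blast
    with \<open>idents q \<subseteq> P\<close> show ?thesis
      by (auto simp: union_trans_def tsp_graph_def)
  qed
  have step_H: "(Inr (config u), a, z) \<in> union_trans ?G ?H \<longleftrightarrow>
      (\<exists>u'. z = Inr (config u') \<and> counter_step u a u')" for u a z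
  proof -
    have "(Inr (config u), a, z) \<in> union_trans ?G ?H \<longleftrightarrow>
        (\<exists>v. z = Inr v \<and> (config u, a, v) \<in> pg_trans ?H)"
      unfolding union_trans_def by blast
    then show ?thesis
      unfolding counter_pda_trans_iff by blast
  qed
  have fwd: "\<exists>u'. counter_step u a u' \<and> (Inl q', Inr (config u')) \<in> R"
    if "(Inl q, Inr (config u)) \<in> R" "tsp_step \<Delta> q a q'" for q u a q'
    using R_step[OF that(1), of a "Inl q'"] that(2) by (auto simp: step_G[OF that(1)] step_H)
  have bwd: "\<exists>q'. tsp_step \<Delta> q a q' \<and> (Inl q', Inr (config u')) \<in> R"
    if qu: "(Inl q, Inr (config u)) \<in> R" "counter_step u a u'" for q u a u'
  proof -
    have "(Inr (config u), Inl q) \<in> R"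
      using symD[OF \<open>sym R\<close> qu(1)] .
    moreover have "(Inr (config u), a, Inr (config u')) \<in> union_trans ?G ?H"
      using qu(2) step_H by blast
    ultimately obtain t' where t': "(Inl q, a, t') \<in> union_trans ?G ?H" "(Inr (config u'), t') \<in> R"
      using R_step by blast
    from t'(1) obtain q' where "t' = Inl q'" "tsp_step \<Delta> q a q'"
      unfolding step_G[OF qu(1)] by blast
    with symD[OF \<open>sym R\<close> t'(2)] show ?thesis by auto
  qed
  show ?thesis
  proof (unfold_locales, goal_cases)
    case 1
    show ?case by fact
  next
    case (2 p u a p')
    then obtain q where "tsp_step \<Delta> q a p'" "(Inl q, Inr (config u)) \<in> R" by blast
    with fwd[of q u a p'] show ?case by blast
  next
    case (3 p u a u')
    then obtain q where q: "\<forall>a r. tsp_step \<Delta> p a r \<longleftrightarrow> tsp_step \<Delta> q a r" "(Inl q, Inr (config u)) \<in> R"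
      by blast
    from bwd[OF q(2) 3(2)] q(1) show ?case by blast
  next
    case (4 p u q)
    then show ?case by simp
  qed
qed

theorem theorem6p3:
  "\<exists>M :: (nat, nat, nat) pda.
     pushdown_automaton M \<and> card (pda_states M) = 2 \<and>
     \<not> (\<exists>(P :: nat set) (\<Delta> :: (nat, nat) tsp_spec) X.
          finite P \<and> recursive_specification P \<Delta> \<and> guarded \<Delta> \<and> X \<in> P \<and>
          bisimilar (tsp_graph P \<Delta> (Ident X)) (pda_graph M))"
proof (intro exI conjI notI; (elim exE conjE)?)
  show "pushdown_automaton counter_pda"
    by (rule pushdown_automaton_counter_pda)
  show "card (pda_states counter_pda) = 2"
    by (simp add: counter_pda_def)
  fix P :: "nat set" and \<Delta> :: "(nat, nat) tsp_spec" and X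
  assume fin: "finite P" and spec: "recursive_specification P \<Delta>" and g: "guarded \<Delta>"
    and X: "X \<in> P" and bis: "bisimilar (tsp_graph P \<Delta> (Ident X)) (pda_graph counter_pda)"
  \<comment> \<open>The initial configuration \<open>(0, [])\<close> is the counter at value 0 in
    the up/down mode.\<close>
  from bis obtain R where R: "bisimulation (tsp_graph P \<Delta> (Ident X)) (pda_graph counter_pda) R"
    and root: "(Inl (Ident X), Inr (config (True, 0))) \<in> R"
    by (auto simp: bisimilar_def tsp_graph_def pda_graph_def counter_pda_def config_def)
  interpret counter_bisimulation \<Delta>
    "\<lambda>p u. \<exists>q. (\<forall>a r. tsp_step \<Delta> p a r \<longleftrightarrow> tsp_step \<Delta> q a r) \<and> (Inl q, Inr (config u)) \<in> R"
    by (rule counter_bisimulationI[OF spec g R])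
  have dom: "dom \<Delta> = P"
    using spec by (simp add: recursive_specification_def)
  then obtain S where "finite S" "subterm_closed \<Delta> S" "Ident ` P \<subseteq> S"
    using finite_subterm_closed_exists[of \<Delta>] fin by metis
  then show False
    using X root by (intro no_finite_subterm_closed[of S "Ident X"]) (auto intro: sequences.base)
qed

end
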